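(* In the setting described in the context, let $\alpha\in\mathbb{R}^N$, let $\bar w_*=\frac1N\sum_{i\in S}w_i$, and define the $K\times K$ matrix $$\Sigma(\alpha)=\frac1N\sum_{i\in S}(H\alpha)_i\,(\pi_i'b)\,(w_i-\bar w_* )(w_i-\bar w_* )'.$$ If $\mathrm{rank}(\Sigma(\alpha))=K-1$, then the null space of $$M(\alpha)=\Pi_S'\,\mathrm{diag}(H\alpha)\,R_SR_S'\,\mathrm{diag}(H\alpha)\,\Pi_S$$ is a one-dimensional subspace. Consequently, the eigenvector associated with the zero eigenvalue of $M(\alpha)$ (normalized to have unit Euclidean norm and positive sum of entries) is unique and equal to $b$.
   Context: Fix $K\ge 2$ and $d\geq 1$, and let $v_1,\dots,v_K\in\mathbb{R}^d$ be the $K$ vertices of a simplex (so they are affinely independent). A weight vector is a vector with nonnegative entries that sum to $1$. For $1\le i\le n$ let $w_i\in\mathbb{R}^K$ be a weight vector and $r_i=\sum_{k=1}^K w_i(k)v_k\in\mathbb{R}^d$. Let $S\subset\{1,\dots,n\}$ with $|S|=N$; for vectors in $\mathbb{R}^N$ coordinates are indexed by $S$. For each $i\in S$ there is $\pi_i\in\mathbb{R}^K$ such that $w_i=(b\circ\pi_i)/\|b\circ\pi_i\|_1$, where $b\in\mathbb{R}^K$ is a vector with positive entries and $\|b\|=1$, and $\circ$ is the entrywise product. Let $\Pi_S\in\mathbb{R}^{N\times K}$ and $R_S\in\mathbb{R}^{N\times d}$ be the matrices whose rows are $\pi_i'$ and $r_i'$ ($i\in S$), respectively, and let $H=I_N-\Pi_S(\Pi_S'\Pi_S)^{-1}\Pi_S'$,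 where $\Pi_S'\Pi_S$ is assumed invertible. For a vector $v$, $\mathrm{diag}(v)$ is the diagonal matrix with diagonal $v$; a prime denotes transpose. *)

theory Defs
  imports "HOL-Analysis.Analysis"
begin

definition weight_vector :: "real ^ 'k \<Rightarrow> bool" where
  "weight_vector x \<longleftrightarrow> (\<forall>k. 0 \<le> x $ k) \<and> (\<Sum>k\<in>UNIV. x $ k) = 1"

definition affinely_independent :: "('k \<Rightarrow> 'a::real_vector) \<Rightarrow> bool" where
  "affinely_independent v \<longleftrightarrow> inj v \<and> \<not> affine_dependent (range v)"

definition l1_norm :: "real ^ 'k \<Rightarrow> real" where
  "l1_norm x = (\<Sum>k\<in>UNIV. \<bar>x $ k\<bar>)"

definition diag :: "real ^ 'm \<Rightarrow> real ^ 'm ^ 'm" where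
  "diag x = (\<chi> i j. if i = j then x $ i else 0)"

definition outer :: "real ^ 'm \<Rightarrow> real ^ 'n \<Rightarrow> real ^ 'n ^ 'm" where
  "outer x y = (\<chi> i j. x $ i * y $ j)"

definition null_space :: "real ^ 'n ^ 'm \<Rightarrow> (real ^ 'n) set" where
  "null_space A = {x. A *v x = 0}"

definition eigenvector :: "real ^ 'n ^ 'n \<Rightarrow> real \<Rightarrow> real ^ 'n \<Rightarrow> bool" where
  "eigenvector A c x \<longleftrightarrow> x \<noteq> 0 \<and> A *v x = c *\<^sub>R x"

text \<open>
  The index set \<open>S\<close> is a finite set of natural numbers, and matrices and vectors with
  coordinates indexed by \<open>S\<close> are represented over a finite type \<open>'s\<close> by means of
  a bijection \<open>e\<close> from \<open>'s\<close> onto \<open>S\<close>: the coordinate \<open>j :: 's\<close> is the one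
  belonging to the index \<open>e j \<in> S\<close>.
\<close>

definition rows_mat :: "('s \<Rightarrow> nat) \<Rightarrow> (nat \<Rightarrow> real ^ 'm) \<Rightarrow> real ^ 'm ^ 's" where
  "rows_mat e x = (\<chi> j. x (e j))"

definition residual_maker :: "real ^ 'k ^ 's \<Rightarrow> real ^ 's ^ 's" where
  "residual_maker P = mat 1 - P ** matrix_inv (transpose P ** P) ** transpose P"

definition barycentric_point :: "('k::finite \<Rightarrow> real ^ 'd) \<Rightarrow> real ^ 'k \<Rightarrow> real ^ 'd" where
  "barycentric_point v x = (\<Sum>k\<in>UNIV. (x $ k) *\<^sub>R v k)"

definition Sigma_mat ::
  "('s::finite \<Rightarrow> nat) \<Rightarrow> (nat \<Rightarrow> real ^ 'k) \<Rightarrow> (nat \<Rightarrow> real ^ 'k) \<Rightarrow> real ^ 'k \<Rightarrow> real ^ 's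
    \<Rightarrow> real ^ 'k ^ 'k" where
  "Sigma_mat e p w b \<alpha> =
    (let H = residual_maker (rows_mat e p);
         wbar = (1 / real CARD('s)) *\<^sub>R (\<Sum>j\<in>UNIV. w (e j))
     in (1 / real CARD('s)) *\<^sub>R
          (\<Sum>j\<in>UNIV. ((H *v \<alpha>) $ j * (p (e j) \<bullet> b)) *\<^sub>R
             outer (w (e j) - wbar) (w (e j) - wbar)))"

definition M_mat ::
  "('s::finite \<Rightarrow> nat) \<Rightarrow> (nat \<Rightarrow> real ^ 'k) \<Rightarrow> (nat \<Rightarrow> real ^ 'd) \<Rightarrow> real ^ 's
    \<Rightarrow> real ^ 'k ^ 'k" where
  "M_mat e p r \<alpha> =
    (let P = rows_mat e p; R = rows_mat e r; D = diag (residual_maker P *v \<alpha>)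
     in transpose P ** D ** R ** transpose R ** D ** P)"

end

theory Submission
  imports Defs
begin

text \<open>
  Let \<open>P\<close>, \<open>R\<close> be the matrices with rows \<open>p\<^sub>i\<close>, \<open>r\<^sub>i\<close> and let \<open>h = H \<alpha>\<close>; then \<open>P' h = 0\<close>.
  As \<open>M = A A'\<close> with \<open>A' = R' diag(h) P\<close>, a vector \<open>x\<close> lies in the null space of \<open>M\<close> iff
  \<open>\<Sum>\<^sub>i h\<^sub>i (p\<^sub>i \<bullet> x) r\<^sub>i = 0\<close>.
  Since \<open>\<Sum>\<^sub>i h\<^sub>i (p\<^sub>i \<bullet> x) = 0\<close>, affine independence of the vertices turns this into
  \<open>\<Sum>\<^sub>i h\<^sub>i (p\<^sub>i \<bullet> x) w\<^sub>i = 0\<close>.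
  With \<open>x = b * y\<close> and \<open>b * p\<^sub>i = (p\<^sub>i \<bullet> b) w\<^sub>i\<close> the left-hand side is \<open>N \<Sigma> y\<close>,
  so the null space of \<open>M\<close> is \<open>b\<close> times that of \<open>\<Sigma>\<close>, which contains \<open>1\<close> and is a line
  by the rank assumption.
\<close>

section \<open>Null spaces: rank-nullity and Gram matrices\<close>

lemma subspace_null_space: "subspace (null_space (A :: real ^ 'n ^ 'm))"
  unfolding null_space_def subspace_def
  by (auto simp: matrix_vector_right_distrib matrix_vector_mult_scaleR)

text \<open>The null space is the orthogonal complement of the row space, whose dimension is the
  rank.\<close>

lemma dim_null_space:
  fixes A :: "real ^ 'n ^ 'm"
  shows "dim (null_space A) + rank A = CARD('n)"
proof -
  have "null_space A = {y \<in> UNIV. \<forall>x \<in> span (rows A). orthogonal x y}"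
  proof (intro equalityI subsetI)
    fix y assume y: "y \<in> {y \<in> UNIV. \<forall>x \<in> span (rows A). orthogonal x y}"
    have "A $ i \<in> span (rows A)" for i
      by (rule span_base) (auto simp: rows_def row_def)
    with y show "y \<in> null_space A"
      by (simp add: null_space_def orthogonal_def vec_eq_iff matrix_vector_mul_component)
  qed (auto simp: null_space_def orthogonal_commute intro: orthogonal_nullspace_rowspace)
  moreover have "dim {y \<in> (UNIV :: (real ^ 'n) set). \<forall>x \<in> span (rows A). orthogonal x y}
      + dim (span (rows A)) = dim (UNIV :: (real ^ 'n) set)"
    by (rule dim_subspace_orthogonal_to_vectors) auto
  ultimately show ?thesis
    by (simp add: row_rank_def)
qed

text \<open>Over the reals \<open>A A' x = 0\<close> forces
  \<open>|A' x|^2 = x \<bullet> (A A' x) = 0\<close>.\<close>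

lemma null_space_mult_transpose:
  fixes A :: "real ^ 'n ^ 'm"
  shows "null_space (A ** transpose A) = null_space (transpose A)"
proof -
  have "transpose A *v x = 0" if "(A ** transpose A) *v x = 0" for x
  proof -
    have "(transpose A *v x) \<bullet> (transpose A *v x) = x \<bullet> ((A ** transpose A) *v x)"
      by (metis dot_lmul_matrix matrix_vector_mul_assoc transpose_matrix_vector)
    with that show ?thesis by simp
  qed
  then show ?thesis
    by (auto simp: null_space_def simp flip: matrix_vector_mul_assoc simp del: transpose_matrix_vector)
qed

section \<open>Matrix-vector products and the residual maker\<close>

lemma transpose_diag [simp]: "transpose (diag x) = diag x"
  by (simp add: diag_def transpose_def vec_eq_iff)

lemma diag_mult_vector: "diag x *v y = x * y"
  by (simp add: diag_def matrix_vector_mult_def vec_eq_iff if_distrib[of "\<lambda>a. a * _"] cong: if_cong)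

lemma outer_mult_vector: "outer x y *v z = (y \<bullet> z) *\<^sub>R x"
  by (simp add: outer_def matrix_vector_mult_def vec_eq_iff inner_vec_def sum_distrib_right
      sum_distrib_left mult_ac)

lemma sum_scaleR_matrix_vector_mult:
  fixes A :: "'i \<Rightarrow> real ^ 'n ^ 'm"
  shows "(\<Sum>i\<in>I. c i *\<^sub>R A i) *v x = (\<Sum>i\<in>I. c i *\<^sub>R (A i *v x))"
  by (induction I rule: infinite_finite_induct)
    (simp_all add: matrix_vector_mult_add_rdistrib scaleR_matrix_vector_assoc)

lemma rows_mat_mult_vector: "rows_mat e x *v y = (\<chi> j. x (e j) \<bullet> y)"
  by (simp add: rows_mat_def matrix_vector_mul_component vec_eq_iff)

lemma transpose_rows_mat_mult_vector:
  "transpose (rows_mat e x) *v y = (\<Sum>j\<in>UNIV. y $ j *\<^sub>R x (e j))"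
  by (simp add: rows_mat_def vector_matrix_mult_def vec_eq_iff mult.commute)

lemma matrix_mult_diff_ldistrib:
  fixes A :: "'a::ring_1 ^ 'n ^ 'm"
  shows "A ** (B - C) = A ** B - A ** C"
  by (simp add: matrix_matrix_mult_def vec_eq_iff sum_subtractf right_diff_distrib)

lemma transpose_mult_residual_maker:
  assumes "invertible (transpose P ** P)"
  shows "transpose P ** residual_maker P = 0"
proof -
  \<comment> \<open>\<open>matrix_inv\<close> is a Hilbert choice; a witness ensures that the chosen
    matrix is an inverse.\<close>
  obtain B where "(transpose P ** P) ** B = mat 1 \<and> B ** (transpose P ** P) = mat 1"
    using assms unfolding invertible_def by blast
  then have "(transpose P ** P) ** matrix_inv (transpose P ** P) = mat 1"
    unfolding matrix_inv_def by (rule someI2) simp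
  then show ?thesis
    by (simp add: residual_maker_def matrix_mult_diff_ldistrib matrix_mul_assoc)
qed

section \<open>Vertices and weights\<close>

lemma affinely_independent_combination_zero:
  fixes v :: "'k::finite \<Rightarrow> 'a::real_vector"
  assumes v: "affinely_independent v" and 0: "(\<Sum>k\<in>UNIV. c k) = 0"
    and s: "(\<Sum>k\<in>UNIV. c k *\<^sub>R v k) = 0"
  shows "c k = 0"
proof (rule ccontr)
  assume "c k \<noteq> 0"
  \<comment> \<open>\<open>affine_dependent\<close> speaks of sets of points, so the coefficients
    move from indices to vertices along the injection \<open>v\<close>.\<close>
  define u where "u = c \<circ> inv v"
  have v': "inj v" "\<not> affine_dependent (range v)" using v by (auto simp: affinely_independent_def)
  have "u (v k) \<noteq> 0" using \<open>c k \<noteq> 0\<close> v' by (simp add: u_def)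
  moreover have "sum u (range v) = 0" "(\<Sum>x\<in>range v. u x *\<^sub>R x) = 0"
    using v' 0 s by (simp_all add: u_def sum.reindex)
  ultimately have "affine_dependent (range v)"
    by (auto simp: affine_dependent_explicit_finite)
  with v' show False by simp
qed

text \<open>The normalizing constant is \<open>q \<bullet> b\<close>: compare the sums of entries,
  using that those of \<open>x\<close> sum to 1.\<close>

lemma weight_vector_reweighted:
  fixes b q x :: "real ^ 'k"
  assumes x: "weight_vector x"
    and eq: "x = (1 / l1_norm (b * q)) *\<^sub>R (b * q)"
  shows "b * q = (q \<bullet> b) *\<^sub>R x"
proof -
  define l where "l = l1_norm (b * q)"
  \<comment> \<open>Since \<open>1 / 0 = 0\<close>, a vanishing norm would give
    \<open>x = 0\<close>.\<close>
  have "x \<noteq> 0" using x by (auto simp: weight_vector_def)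
  then have "l \<noteq> 0" using eq by (auto simp: l_def)
  then have bq: "b * q = l *\<^sub>R x" using eq by (simp flip: l_def)
  have "q \<bullet> b = (\<Sum>k\<in>UNIV. (b * q) $ k)" by (simp add: inner_vec_def mult.commute)
  also have "\<dots> = l * (\<Sum>k\<in>UNIV. x $ k)" unfolding bq by (simp add: sum_distrib_left)
  finally have "q \<bullet> b = l" using x by (simp add: weight_vector_def)
  with bq show ?thesis by simp
qed

section \<open>Orthogonality of the residuals and the action of \<Sigma> and M\<close>

lemma sum_residual_scaleR_rows:
  assumes "invertible (transpose (rows_mat e p) ** rows_mat e p)"
  shows "(\<Sum>j\<in>UNIV. (residual_maker (rows_mat e p) *v \<alpha>) $ j *\<^sub>R p (e j)) = 0"
proof -
  have "transpose (rows_mat e p) *v (residual_maker (rows_mat e p) *v \<alpha>) = 0"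
    using transpose_mult_residual_maker[OF assms]
    by (simp add: matrix_vector_mul_assoc del: transpose_matrix_vector)
  then show ?thesis
    by (simp only: transpose_rows_mat_mult_vector)
qed

text \<open>Entrywise multiplication by \<open>b\<close> turns the orthogonality relation for the
  \<open>p (e j)\<close> into one for the weights. It serves both to remove the centring and to put
  the all-ones vector into the null space of \<Sigma>.\<close>

lemma sum_residual_scaleR_weights:
  fixes e :: "'s::finite \<Rightarrow> nat" and w p :: "nat \<Rightarrow> real ^ 'k"
  assumes inv: "invertible (transpose (rows_mat e p) ** rows_mat e p)"
    and b: "\<And>j. b * p (e j) = (p (e j) \<bullet> b) *\<^sub>R w (e j)"
  shows "(\<Sum>j\<in>UNIV. ((residual_maker (rows_mat e p) *v \<alpha>) $ j * (p (e j) \<bullet> b)) *\<^sub>R w (e j)) = 0"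
proof -
  let ?h = "residual_maker (rows_mat e p) *v \<alpha>"
  have "(\<Sum>j\<in>UNIV. (?h $ j * (p (e j) \<bullet> b)) *\<^sub>R w (e j)) = (\<Sum>j\<in>UNIV. ?h $ j *\<^sub>R (b * p (e j)))"
    by (simp add: b)
  also have "\<dots> = b * (\<Sum>j\<in>UNIV. ?h $ j *\<^sub>R p (e j))"
    by (simp add: vec_eq_iff sum_distrib_left mult_ac)
  also have "\<dots> = 0"
    by (simp add: sum_residual_scaleR_rows[OF inv] vec_eq_iff)
  finally show ?thesis .
qed

text \<open>The centring of the weights has no effect, because the residuals are orthogonal to the
  columns of the matrix of the \<open>p (e j)\<close>.\<close>
lemma Sigma_mat_mult_vector:
  fixes e :: "'s::finite \<Rightarrow> nat" and w p :: "nat \<Rightarrow> real ^ 'k"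
  assumes inv: "invertible (transpose (rows_mat e p) ** rows_mat e p)"
    and b: "\<And>j. b * p (e j) = (p (e j) \<bullet> b) *\<^sub>R w (e j)"
  shows "Sigma_mat e p w b \<alpha> *v y
    = (1 / real CARD('s)) *\<^sub>R (\<Sum>j\<in>UNIV.
        ((residual_maker (rows_mat e p) *v \<alpha>) $ j * (p (e j) \<bullet> (b * y))) *\<^sub>R w (e j))"
proof -
  define h where "h = residual_maker (rows_mat e p) *v \<alpha>"
  define g where "g j = h $ j * (p (e j) \<bullet> b)" for j
  define m where "m = (1 / real CARD('s)) *\<^sub>R (\<Sum>j\<in>UNIV. w (e j))"
  have hp: "(\<Sum>j\<in>UNIV. h $ j *\<^sub>R p (e j)) = 0"
    unfolding h_def by (rule sum_residual_scaleR_rows[OF inv])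
  have "(\<Sum>j\<in>UNIV. g j) = (\<Sum>j\<in>UNIV. h $ j *\<^sub>R p (e j)) \<bullet> b"
    by (simp add: g_def inner_sum_left)
  then have g0: "(\<Sum>j\<in>UNIV. g j) = 0" by (simp add: hp)
  have gw: "(\<Sum>j\<in>UNIV. g j *\<^sub>R w (e j)) = 0"
    unfolding g_def h_def by (rule sum_residual_scaleR_weights[OF inv b])
  have "(\<Sum>j\<in>UNIV. g j * (w (e j) \<bullet> y)) = (\<Sum>j\<in>UNIV. g j *\<^sub>R w (e j)) \<bullet> y"
    by (simp add: inner_sum_left)
  then have gy: "(\<Sum>j\<in>UNIV. g j * (w (e j) \<bullet> y)) = 0" by (simp add: gw)
  \<comment> \<open>After summation only the first of the four terms survives; the others vanish by
    \<open>gw\<close>, \<open>gy\<close> and \<open>g0\<close>.\<close>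
  have "(g j * ((w (e j) - m) \<bullet> y)) *\<^sub>R (w (e j) - m)
      = (g j * (w (e j) \<bullet> y)) *\<^sub>R w (e j) - (m \<bullet> y) *\<^sub>R (g j *\<^sub>R w (e j))
        - (g j * (w (e j) \<bullet> y)) *\<^sub>R m + g j *\<^sub>R ((m \<bullet> y) *\<^sub>R m)" for j
    by (simp add: inner_diff_left algebra_simps)
  then have "(\<Sum>j\<in>UNIV. (g j * ((w (e j) - m) \<bullet> y)) *\<^sub>R (w (e j) - m))
      = (\<Sum>j\<in>UNIV. (g j * (w (e j) \<bullet> y)) *\<^sub>R w (e j))
        - (m \<bullet> y) *\<^sub>R (\<Sum>j\<in>UNIV. g j *\<^sub>R w (e j))
        - (\<Sum>j\<in>UNIV. g j * (w (e j) \<bullet> y)) *\<^sub>R m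
        + (\<Sum>j\<in>UNIV. g j) *\<^sub>R ((m \<bullet> y) *\<^sub>R m)"
    by (simp only: sum.distrib sum_subtractf scaleR_sum_left[symmetric] scaleR_sum_right[symmetric])
  also have "\<dots> = (\<Sum>j\<in>UNIV. (g j * (w (e j) \<bullet> y)) *\<^sub>R w (e j))"
    by (simp only: g0 gw gy) simp
  also have "\<dots> = (\<Sum>j\<in>UNIV. (h $ j * (p (e j) \<bullet> (b * y))) *\<^sub>R w (e j))"
  proof -
    have "p (e j) \<bullet> (b * y) = (b * p (e j)) \<bullet> y" for j
      by (simp add: inner_vec_def mult_ac)
    then show ?thesis by (simp add: b g_def mult_ac)
  qed
  finally have eq: "(\<Sum>j\<in>UNIV. (g j * ((w (e j) - m) \<bullet> y)) *\<^sub>R (w (e j) - m))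
      = (\<Sum>j\<in>UNIV. (h $ j * (p (e j) \<bullet> (b * y))) *\<^sub>R w (e j))" .
  have "Sigma_mat e p w b \<alpha>
      = (1 / real CARD('s)) *\<^sub>R (\<Sum>j\<in>UNIV. g j *\<^sub>R outer (w (e j) - m) (w (e j) - m))"
    by (simp add: Sigma_mat_def Let_def g_def h_def m_def)
  then show ?thesis
    by (simp add: sum_scaleR_matrix_vector_mult outer_mult_vector eq h_def
        flip: scaleR_matrix_vector_assoc)
qed

lemma mem_null_space_M_mat_iff:
  fixes e :: "'s::finite \<Rightarrow> nat" and v :: "'k::finite \<Rightarrow> real ^ 'd"
    and w p :: "nat \<Rightarrow> real ^ 'k"
  assumes inv: "invertible (transpose (rows_mat e p) ** rows_mat e p)"
    and v: "affinely_independent v"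
    and w: "\<And>j. weight_vector (w (e j))"
    and r: "\<And>j. r (e j) = barycentric_point v (w (e j))"
  shows "x \<in> null_space (M_mat e p r \<alpha>) \<longleftrightarrow>
    (\<Sum>j\<in>UNIV. ((residual_maker (rows_mat e p) *v \<alpha>) $ j * (p (e j) \<bullet> x)) *\<^sub>R w (e j)) = 0"
proof -
  define h where "h = residual_maker (rows_mat e p) *v \<alpha>"
  define A where "A = transpose (rows_mat e p) ** diag h ** rows_mat e r"
  define s where "s = (\<Sum>j\<in>UNIV. (h $ j * (p (e j) \<bullet> x)) *\<^sub>R w (e j))"
  have tA: "transpose A = transpose (rows_mat e r) ** diag h ** rows_mat e p"
    by (simp add: A_def matrix_transpose_mul matrix_mul_assoc)
  have "M_mat e p r \<alpha> = A ** transpose A"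
    unfolding tA by (simp add: M_mat_def Let_def A_def h_def matrix_mul_assoc)
  then have "x \<in> null_space (M_mat e p r \<alpha>) \<longleftrightarrow> transpose A *v x = 0"
    by (simp add: null_space_mult_transpose del: transpose_matrix_vector) (simp add: null_space_def)
  also have "transpose A *v x = (\<Sum>j\<in>UNIV. (h $ j * (p (e j) \<bullet> x)) *\<^sub>R r (e j))"
    unfolding tA
    by (simp add: transpose_rows_mat_mult_vector diag_mult_vector rows_mat_mult_vector
        flip: matrix_vector_mul_assoc del: transpose_matrix_vector)
  \<comment> \<open>Exchanging the sums exhibits the entries of \<open>s\<close> as coefficients of
    the vertices.\<close>
  also have "\<dots> = (\<Sum>k\<in>UNIV. s $ k *\<^sub>R v k)"
    unfolding r barycentric_point_def s_def
    by (simp add: scaleR_sum_right scaleR_sum_left) (rule sum.swap)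
  also have "\<dots> = 0 \<longleftrightarrow> s = 0"
  proof
    assume 0: "(\<Sum>k\<in>UNIV. s $ k *\<^sub>R v k) = 0"
    \<comment> \<open>Affine independence applies only to coefficients with sum zero; here each
      weight vector contributes 1 and \<open>P' h = 0\<close> does the rest.\<close>
    have "(\<Sum>k\<in>UNIV. s $ k) = (\<Sum>j\<in>UNIV. h $ j * (p (e j) \<bullet> x) * (\<Sum>k\<in>UNIV. w (e j) $ k))"
      unfolding s_def by (simp add: sum_distrib_left) (rule sum.swap)
    also have "\<dots> = (\<Sum>j\<in>UNIV. h $ j *\<^sub>R p (e j)) \<bullet> x"
      using w by (simp add: weight_vector_def inner_sum_left)
    also have "\<dots> = 0"
      using sum_residual_scaleR_rows[OF inv, of \<alpha>] by (simp add: h_def)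
    finally show "s = 0"
      using affinely_independent_combination_zero[OF v _ 0] by (simp add: vec_eq_iff)
  qed simp
  finally show ?thesis by (simp add: s_def h_def)
qed

section \<open>Transfer of the null space from \<Sigma> to M, and normalization\<close>

theorem theorem2p2:
  fixes n N :: nat
    and S :: "nat set"
    and e :: "'s::finite \<Rightarrow> nat"
    and v :: "'k::finite \<Rightarrow> real ^ 'd"
    and w p :: "nat \<Rightarrow> real ^ 'k"
    and r :: "nat \<Rightarrow> real ^ 'd"
    and b :: "real ^ 'k"
    and \<alpha> :: "real ^ 's"
  assumes "CARD('k) \<ge> 2"
    and "affinely_independent v"
    and "\<And>i. i \<in> {1..n} \<Longrightarrow> weight_vector (w i)"
    and "\<And>i. i \<in> {1..n} \<Longrightarrow> r i = barycentric_point v (w i)"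
    and "S \<subseteq> {1..n}" and "card S = N"
    and "bij_betw e UNIV S"
    and "\<And>k. b $ k > 0" and "norm b = 1"
    \<comment> \<open>\<open>*\<close> on \<open>real ^ 'k\<close> is the entrywise product\<close>
    and "\<And>i. i \<in> S \<Longrightarrow> w i = (1 / l1_norm (b * p i)) *\<^sub>R (b * p i)"
    and "invertible (transpose (rows_mat e p) ** rows_mat e p)"
    and "rank (Sigma_mat e p w b \<alpha>) = CARD('k) - 1"
  shows "subspace (null_space (M_mat e p r \<alpha>)) \<and> dim (null_space (M_mat e p r \<alpha>)) = 1
    \<and> (\<forall>x. eigenvector (M_mat e p r \<alpha>) 0 x \<and> norm x = 1 \<and> (\<Sum>k\<in>UNIV. x $ k) > 0
          \<longleftrightarrow> x = b)"
proof -
  let ?\<Sigma> = "Sigma_mat e p w b \<alpha>" and ?N = "null_space (M_mat e p r \<alpha>)"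
  have eS: "e j \<in> S" "e j \<in> {1..n}" for j
    using assms(5,7) by (force simp: bij_betw_def)+
  have bp: "b * p (e j) = (p (e j) \<bullet> b) *\<^sub>R w (e j)" for j
    by (rule weight_vector_reweighted[OF assms(3)[OF eS(2)] assms(10)[OF eS(1)]])
  \<comment> \<open>Both conditions say that the same weighted sum vanishes, up to the nonzero
    factor \<open>1 / CARD('s)\<close>.\<close>
  have mem: "b * y \<in> ?N \<longleftrightarrow> y \<in> null_space ?\<Sigma>" for y
    using mem_null_space_M_mat_iff[OF assms(11,2), of w r "b * y" \<alpha>] assms(3,4) eS(2)
      Sigma_mat_mult_vector[OF assms(11) bp]
    by (simp add: null_space_def)
  have b0: "b \<noteq> 0" using assms(9) by auto
  have one: "(1 :: real ^ 'k) \<in> null_space ?\<Sigma>"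
    using Sigma_mat_mult_vector[OF assms(11) bp, of \<alpha> 1]
      sum_residual_scaleR_weights[OF assms(11) bp, of \<alpha>]
    by (simp add: null_space_def)
  have "dim (null_space ?\<Sigma>) = 1"
    using dim_null_space[of ?\<Sigma>] assms(1,12) by simp
  \<comment> \<open>A line contained in a subspace of dimension 1 fills it.\<close>
  then have span1: "null_space ?\<Sigma> = span {1}"
    using one subspace_dim_equal[of "span {1}" "null_space ?\<Sigma>"]
      span_minimal[of "{1}" "null_space ?\<Sigma>"] subspace_null_space[of ?\<Sigma>]
    by (simp add: dim_insert)
  have N: "?N = span {b}"
  proof -
    have "x \<in> ?N \<longleftrightarrow> (\<exists>c. x = c *\<^sub>R b)" for x
    proof -
      \<comment> \<open>As \<open>b\<close> has positive entries, every \<open>x\<close> is of the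
        form \<open>b * y\<close>, and \<open>y\<close> is constant exactly when \<open>x\<close> is
        a multiple of \<open>b\<close>.\<close>
      define y where "y = (\<chi> k. x $ k / b $ k)"
      have bk: "b $ k \<noteq> 0" for k using assms(8)[of k] by simp
      have x: "x = b * y" by (simp add: y_def vec_eq_iff bk)
      have "x \<in> ?N \<longleftrightarrow> (\<exists>c. y = c *\<^sub>R 1)"
        unfolding x mem span1 by (auto simp: span_singleton)
      also have "\<dots> \<longleftrightarrow> (\<exists>c. x = c *\<^sub>R b)"
        by (simp add: y_def vec_eq_iff bk divide_eq_eq)
      finally show ?thesis .
    qed
    then show ?thesis by (auto simp: span_singleton)
  qed
  have "dim ?N = 1" unfolding N by (simp add: dim_insert b0)
  moreover have "eigenvector (M_mat e p r \<alpha>) 0 x \<and> norm x = 1 \<and> (\<Sum>k\<in>UNIV. x $ k) > 0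
      \<longleftrightarrow> x = b" for x
  proof -
    have sb: "(\<Sum>k\<in>UNIV. b $ k) > 0" by (rule sum_pos) (auto simp: assms(8))
    have ev: "eigenvector (M_mat e p r \<alpha>) 0 x \<longleftrightarrow> x \<noteq> 0 \<and> x \<in> span {b}"
      unfolding N[symmetric] by (simp add: eigenvector_def null_space_def)
    show ?thesis
    proof
      assume x: "eigenvector (M_mat e p r \<alpha>) 0 x \<and> norm x = 1 \<and> (\<Sum>k\<in>UNIV. x $ k) > 0"
      then obtain c where c: "x = c *\<^sub>R b" unfolding ev by (auto simp: span_singleton)
      \<comment> \<open>Unit norms leave \<open>c = 1\<close> or \<open>c = -1\<close>; the positive
        sum of entries fixes the sign.\<close>
      have "0 < c * (\<Sum>k\<in>UNIV. b $ k)" using x by (simp add: c sum_distrib_left)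
      then have "c > 0" using sb by (simp add: zero_less_mult_iff)
      then show "x = b" using x assms(9) by (simp add: c)
    next
      assume "x = b"
      then show "eigenvector (M_mat e p r \<alpha>) 0 x \<and> norm x = 1 \<and> (\<Sum>k\<in>UNIV. x $ k) > 0"
        unfolding ev using b0 sb assms(9) by (simp add: span_base)
    qed
  qed
  ultimately show ?thesis by (simp add: subspace_null_space)
qed

end
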